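(* Let $\mathcal{P}$ be a van Kampen diagram on a surface $\Sigma$ and let $P\in\mathcal{P}$ be a disk with vertex set $V_P$. Then $$-\kappa(P)\geq\frac{\beta(P)-6}{6}.$$
   Context: A van Kampen diagram on a compact surface $\Sigma$ over a presentation $\langle\mathcal{S}\mid\mathcal{R}\rangle$ is a decomposition of $\Sigma$ into finitely many labelled polygons ("disks") whose boundaries read reduced elements of $\mathcal{R}^{\pm}$, with compatible labels on shared edges; by concatenating edges one assumes every vertex has degree at least $3$. For a disk $P$ with vertices $V_P$ and edges $E_P$: $\deg(v)$ is the number of edges adjacent to $v$, $\deg'(v)$ the number of disks adjacent to $v$, $\epsilon(e)\in\{1,2\}$ the number of disks adjacent to $e$; $\kappa(P)=\sum_{v\in V_P}\frac{1}{\deg'(v)}-\sum_{e\in E_P}\frac{1}{\epsilon(e)}+1$; $\beta(v)=1$ if $\deg(v)\geq3$ and $0$ otherwise; $\beta(P)=\sum_{v\in V_P}\beta(v)$. *)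

theory Defs
  imports Main Complex_Main
begin

text \<open>
Combinatorial model of a polygonal decomposition of a compact surface.
Disks are indexed by a finite set F; disk f is a polygon with n f \<ge> 1 sides.
Side (f,i), i < n f, runs from corner (f,i) to corner (f, Suc i mod n f).
The partial map glue pairs sides: glue s = Some (t, r) means that side s is
glued to side t (t \<noteq> s), with r = True iff the two boundary readings traverse
the common edge in opposite directions.  Unglued sides lie on the boundary of
the surface.  Vertices are classes of corners under the identifications
induced by the gluing (the quotient is always a compact surface, possibly with
boundary).  Words over the generators are lists of (generator, exponent sign).
\<close>

type_synonym ('a) word = "('a \<times> bool) list"

definition sides :: "'f set \<Rightarrow> ('f \<Rightarrow> nat) \<Rightarrow> ('f \<times> nat) set" where
  "sides F n = {(f, i). f \<in> F \<and> i < n f}"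

definition nxt :: "('f \<Rightarrow> nat) \<Rightarrow> 'f \<times> nat \<Rightarrow> 'f \<times> nat" where
  "nxt n s = (fst s, Suc (snd s) mod n (fst s))"

definition corner_rel ::
  "('f \<Rightarrow> nat) \<Rightarrow> ('f \<times> nat \<Rightarrow> (('f \<times> nat) \<times> bool) option)
   \<Rightarrow> 'f \<times> nat \<Rightarrow> 'f \<times> nat \<Rightarrow> bool" where
  "corner_rel n glue c d \<longleftrightarrow>
     (\<exists>s t r. glue s = Some (t, r) \<and>
        (if r then (c = s \<and> d = nxt n t) \<or> (c = nxt n s \<and> d = t)
              else (c = s \<and> d = t) \<or> (c = nxt n s \<and> d = nxt n t)))"

definition vertex_of ::
  "('f \<Rightarrow> nat) \<Rightarrow> ('f \<times> nat \<Rightarrow> (('f \<times> nat) \<times> bool) option)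
   \<Rightarrow> 'f \<times> nat \<Rightarrow> ('f \<times> nat) set" where
  "vertex_of n glue c = {d. (\<lambda>x y. corner_rel n glue x y \<or> corner_rel n glue y x)\<^sup>*\<^sup>* c d}"

text \<open>deg' of the vertex at corner c: number of disks adjacent to it (counted
  with multiplicity, i.e. number of corners at that vertex).\<close>
definition degp ::
  "('f \<Rightarrow> nat) \<Rightarrow> ('f \<times> nat \<Rightarrow> (('f \<times> nat) \<times> bool) option) \<Rightarrow> 'f \<times> nat \<Rightarrow> nat" where
  "degp n glue c = card (vertex_of n glue c)"

text \<open>Side ends: (s, False) is the start of side s, (s, True) its end.\<close>
definition end_corner :: "('f \<Rightarrow> nat) \<Rightarrow> ('f \<times> nat) \<times> bool \<Rightarrow> 'f \<times> nat" where
  "end_corner n se = (if snd se then nxt n (fst se) else fst se)"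

definition end_partner ::
  "('f \<times> nat \<Rightarrow> (('f \<times> nat) \<times> bool) option) \<Rightarrow> ('f \<times> nat) \<times> bool \<Rightarrow> ('f \<times> nat) \<times> bool" where
  "end_partner glue se = (case glue (fst se) of None \<Rightarrow> se
      | Some (t, r) \<Rightarrow> (t, if r then \<not> snd se else snd se))"

text \<open>An edge end is a side end up to the gluing identification.\<close>
definition edge_end ::
  "('f \<times> nat \<Rightarrow> (('f \<times> nat) \<times> bool) option) \<Rightarrow> ('f \<times> nat) \<times> bool \<Rightarrow> (('f \<times> nat) \<times> bool) set" where
  "edge_end glue se = {se, end_partner glue se}"

text \<open>deg of the vertex at corner c: number of edge ends at that vertex
  (a loop at v counts twice).\<close>
definition deg ::
  "'f set \<Rightarrow> ('f \<Rightarrow> nat) \<Rightarrow> ('f \<times> nat \<Rightarrow> (('f \<times> nat) \<times> bool) option) \<Rightarrow> 'f \<times> nat \<Rightarrow> nat" where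
  "deg F n glue c = card (edge_end glue `
      {se. fst se \<in> sides F n \<and> end_corner n se \<in> vertex_of n glue c})"

text \<open>epsilon(e): number of disks adjacent to the edge containing side s.\<close>
definition eps :: "('f \<times> nat \<Rightarrow> (('f \<times> nat) \<times> bool) option) \<Rightarrow> 'f \<times> nat \<Rightarrow> nat" where
  "eps glue s = (if glue s = None then 1 else 2)"

definition kappa ::
  "('f \<Rightarrow> nat) \<Rightarrow> ('f \<times> nat \<Rightarrow> (('f \<times> nat) \<times> bool) option) \<Rightarrow> 'f \<Rightarrow> real" where
  "kappa n glue P = (\<Sum>i<n P. 1 / real (degp n glue (P, i)))
                   - (\<Sum>i<n P. 1 / real (eps glue (P, i))) + 1"

definition beta_v ::
  "'f set \<Rightarrow> ('f \<Rightarrow> nat) \<Rightarrow> ('f \<times> nat \<Rightarrow> (('f \<times> nat) \<times> bool) option) \<Rightarrow> 'f \<times> nat \<Rightarrow> nat" where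
  "beta_v F n glue c = (if deg F n glue c \<ge> 3 then 1 else 0)"

definition beta ::
  "'f set \<Rightarrow> ('f \<Rightarrow> nat) \<Rightarrow> ('f \<times> nat \<Rightarrow> (('f \<times> nat) \<times> bool) option) \<Rightarrow> 'f \<Rightarrow> nat" where
  "beta F n glue P = (\<Sum>i<n P. beta_v F n glue (P, i))"

definition word_inv :: "'a word \<Rightarrow> 'a word" where
  "word_inv w = rev (map (\<lambda>(a, b). (a, \<not> b)) w)"

definition reduced :: "'a word \<Rightarrow> bool" where
  "reduced w \<longleftrightarrow> (\<forall>i. Suc i < length w \<longrightarrow>
      \<not> (fst (w ! i) = fst (w ! Suc i) \<and> snd (w ! i) \<noteq> snd (w ! Suc i)))"

definition boundary_word ::
  "('f \<Rightarrow> nat) \<Rightarrow> ('f \<times> nat \<Rightarrow> 'a word) \<Rightarrow> 'f \<Rightarrow> 'a word" where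
  "boundary_word n lab f = concat (map (\<lambda>i. lab (f, i)) [0..<n f])"

text \<open>Van Kampen diagram on a compact surface over the presentation \<langle>S | R\<rangle>,
  with the standing assumption that every vertex has degree at least 3.\<close>
definition vk_diagram ::
  "'a set \<Rightarrow> 'a word set \<Rightarrow> 'f set \<Rightarrow> ('f \<Rightarrow> nat)
   \<Rightarrow> ('f \<times> nat \<Rightarrow> (('f \<times> nat) \<times> bool) option) \<Rightarrow> ('f \<times> nat \<Rightarrow> 'a word) \<Rightarrow> bool" where
  "vk_diagram S R F n glue lab \<longleftrightarrow>
     R \<subseteq> lists (S \<times> UNIV) \<and>
     finite F \<and> (\<forall>f\<in>F. 1 \<le> n f) \<and>
     (\<forall>s t r. glue s = Some (t, r) \<longrightarrow>
        s \<in> sides F n \<and> t \<in> sides F n \<and> t \<noteq> s \<and> glue t = Some (s, r)) \<and>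
     (\<forall>s\<in>sides F n. lab s \<noteq> [] \<and> lab s \<in> lists (S \<times> UNIV)) \<and>
     (\<forall>s t r. glue s = Some (t, r) \<longrightarrow> lab t = (if r then word_inv (lab s) else lab s)) \<and>
     (\<forall>f\<in>F. \<exists>k. reduced (rotate k (boundary_word n lab f)) \<and>
                 rotate k (boundary_word n lab f) \<in> R \<union> word_inv ` R) \<and>
     (\<forall>c\<in>sides F n. 3 \<le> deg F n glue c)"

end

theory Submission
  imports Defs
begin

text \<open>
  Split the weight 1/epsilon(e) of each side of P equally between its two end corners, so that a
  corner c receives at least 1/2, and at least 3/4 if one of the two sides at c lies on the
  boundary. It suffices that this share exceeds 1/deg'(c) by 1/6. As every vertex has degree at
  least 3, deg'(c) = 1 is impossible (a single corner carries only two side ends), and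
  deg'(c) = 2 forces a boundary side at c: otherwise the four side ends at the vertex pair up into
  two edges, unless the two sides at c are glued to each other, which makes c the only corner of
  its vertex. Summing over the corners, and noting that beta(P) counts all of them, gives the bound.
\<close>

definition prv :: "('f \<Rightarrow> nat) \<Rightarrow> 'f \<times> nat \<Rightarrow> 'f \<times> nat" where
  "prv n s = (fst s, (snd s + n (fst s) - 1) mod n (fst s))"

lemma nxt_prv: "s \<in> sides F n \<Longrightarrow> nxt n (prv n s) = s"
  by (cases s) (auto simp: sides_def nxt_def prv_def mod_Suc_eq)

lemma prv_nxt: "s \<in> sides F n \<Longrightarrow> prv n (nxt n s) = s"
  by (cases s) (auto simp: sides_def nxt_def prv_def mod_if)

lemma side_end_at_corner:
  assumes "fst x \<in> sides F n" and "end_corner n x = y"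
  shows "x = (y, False) \<or> x = (prv n y, True)"
  using assms by (cases x; cases "snd x") (auto simp: end_corner_def prv_nxt)

lemma deg_le_twice_degp:
  assumes "finite (vertex_of n glue c)"
  shows "deg F n glue c \<le> 2 * degp n glue c"
proof -
  define V where "V = vertex_of n glue c"
  define SE where "SE = {se. fst se \<in> sides F n \<and> end_corner n se \<in> V}"
  define U where "U = (\<Union>y\<in>V. {(y, False), (prv n y, True)})"
  have "SE \<subseteq> U"
  proof
    fix x assume "x \<in> SE"
    then have "fst x \<in> sides F n" "end_corner n x \<in> V" by (auto simp: SE_def)
    then show "x \<in> U"
      using side_end_at_corner[of x F n "end_corner n x"] unfolding U_def by blast
  qed
  have "finite V" using assms by (simp add: V_def)
  then have "finite U" by (simp add: U_def)
  have "card U \<le> (\<Sum>y\<in>V. card {(y, False), (prv n y, True)})"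
    unfolding U_def using \<open>finite V\<close> by (rule card_UN_le)
  also have "\<dots> \<le> (\<Sum>y\<in>V. 2)"
    by (rule sum_mono) (simp add: card_insert_le_m1)
  finally have "card U \<le> 2 * card V" by simp
  have "card (edge_end glue ` SE) \<le> card SE"
    using \<open>SE \<subseteq> U\<close> \<open>finite U\<close> by (intro card_image_le) (rule finite_subset)
  also have "\<dots> \<le> card U"
    using \<open>SE \<subseteq> U\<close> \<open>finite U\<close> by (rule card_mono[rotated])
  finally show ?thesis
    using \<open>card U \<le> 2 * card V\<close> by (simp add: deg_def degp_def SE_def V_def)
qed

lemma degp_neq_1:
  assumes "3 \<le> deg F n glue c"
  shows "degp n glue c \<noteq> 1"
proof
  assume "degp n glue c = 1"
  then have "finite (vertex_of n glue c)"
    by (simp add: degp_def card_ge_0_finite)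
  then have "deg F n glue c \<le> 2"
    using deg_le_twice_degp \<open>degp n glue c = 1\<close> by fastforce
  with assms show False by simp
qed

definition proper_gluing ::
  "'f set \<Rightarrow> ('f \<Rightarrow> nat) \<Rightarrow> ('f \<times> nat \<Rightarrow> (('f \<times> nat) \<times> bool) option) \<Rightarrow> bool" where
  "proper_gluing F n glue \<longleftrightarrow>
     (\<forall>s t r. glue s = Some (t, r) \<longrightarrow>
        s \<in> sides F n \<and> t \<in> sides F n \<and> t \<noteq> s \<and> glue t = Some (s, r))"

lemma vk_diagram_proper_gluing: "vk_diagram S R F n glue lab \<Longrightarrow> proper_gluing F n glue"
  unfolding vk_diagram_def proper_gluing_def by blast

lemma glued_side_in_sides:
  assumes "proper_gluing F n glue" and "glue s \<noteq> None"
  shows "s \<in> sides F n"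
proof -
  obtain t r where "glue s = Some (t, r)" using assms(2) by auto
  with assms(1) show ?thesis unfolding proper_gluing_def by blast
qed

lemma end_partner_involution:
  assumes "proper_gluing F n glue"
  shows "end_partner glue (end_partner glue x) = x"
proof (cases "glue (fst x)")
  case (Some tr)
  then obtain t r where g: "glue (fst x) = Some (t, r)" by (cases tr) blast
  with assms have "glue t = Some (fst x, r)" unfolding proper_gluing_def by blast
  with g show ?thesis by (simp add: end_partner_def)
qed (simp add: end_partner_def)

lemma end_partner_glued:
  assumes "proper_gluing F n glue" and "glue (fst x) \<noteq> None"
  shows "end_partner glue x \<noteq> x" and "fst (end_partner glue x) \<in> sides F n"
    and "glue (fst (end_partner glue x)) \<noteq> None"
proof -
  obtain t r where g: "glue (fst x) = Some (t, r)" using assms(2) by auto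
  from assms(1) g have "t \<noteq> fst x" "t \<in> sides F n" "glue t = Some (fst x, r)"
    unfolding proper_gluing_def by blast+
  then show "end_partner glue x \<noteq> x" and "fst (end_partner glue x) \<in> sides F n"
    and "glue (fst (end_partner glue x)) \<noteq> None"
    using g by (auto simp: end_partner_def prod_eq_iff)
qed

lemma edge_end_end_partner:
  "proper_gluing F n glue \<Longrightarrow> edge_end glue (end_partner glue x) = edge_end glue x"
  by (auto simp: edge_end_def end_partner_involution)

lemma corner_rel_iff:
  "corner_rel n glue y z \<longleftrightarrow>
     (\<exists>x. glue (fst x) \<noteq> None \<and> end_corner n x = y \<and> end_corner n (end_partner glue x) = z)"
proof
  assume "corner_rel n glue y z"
  then obtain s t r where g: "glue s = Some (t, r)" and
    c: "if r then (y = s \<and> z = nxt n t) \<or> (y = nxt n s \<and> z = t)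
              else (y = s \<and> z = t) \<or> (y = nxt n s \<and> z = nxt n t)"
    unfolding corner_rel_def by blast
  have ep: "end_partner glue (s, b) = (t, if r then \<not> b else b)" for b
    using g by (simp add: end_partner_def)
  from c have "\<exists>b. y = end_corner n (s, b) \<and> z = end_corner n (end_partner glue (s, b))"
    by (cases r) (auto simp: ep end_corner_def intro: exI[of _ True] exI[of _ False])
  then obtain b where "y = end_corner n (s, b)" "z = end_corner n (end_partner glue (s, b))"
    by blast
  with g show "\<exists>x. glue (fst x) \<noteq> None \<and> end_corner n x = y \<and> end_corner n (end_partner glue x) = z"
    by (intro exI[of _ "(s, b)"]) simp
next
  assume "\<exists>x. glue (fst x) \<noteq> None \<and> end_corner n x = y \<and> end_corner n (end_partner glue x) = z"
  then obtain s b t r where "glue s = Some (t, r)" "end_corner n (s, b) = y"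
    "end_corner n (end_partner glue (s, b)) = z" by auto
  then show "corner_rel n glue y z"
    unfolding corner_rel_def
    by (intro exI[of _ s] exI[of _ t] exI[of _ r])
      (cases r; cases b; auto simp: end_corner_def end_partner_def)
qed

lemma corner_rel_sym:
  assumes "proper_gluing F n glue" and "corner_rel n glue y z"
  shows "corner_rel n glue z y"
proof -
  obtain x where "glue (fst x) \<noteq> None" "end_corner n x = y" "end_corner n (end_partner glue x) = z"
    using assms(2) corner_rel_iff by blast
  then have "glue (fst (end_partner glue x)) \<noteq> None" "end_corner n (end_partner glue x) = z"
    "end_corner n (end_partner glue (end_partner glue x)) = y"
    using end_partner_glued(3)[OF assms(1)] end_partner_involution[OF assms(1)] by auto
  then show ?thesis
    unfolding corner_rel_iff by blast
qed

lemma end_partner_at_vertex: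
  assumes "end_corner n x \<in> vertex_of n glue c"
  shows "end_corner n (end_partner glue x) \<in> vertex_of n glue c"
proof (cases "glue (fst x) = None")
  case True
  then show ?thesis using assms by (simp add: end_partner_def)
next
  case False
  then have "corner_rel n glue (end_corner n x) (end_corner n (end_partner glue x))"
    unfolding corner_rel_iff by blast
  with assms show ?thesis
    unfolding vertex_of_def by (auto intro: rtranclp.rtrancl_into_rtrancl)
qed

lemma vertex_of_fold:
  assumes pg: "proper_gluing F n glue" and c: "c \<in> sides F n"
    and fold: "end_partner glue (c, False) = (prv n c, True)"
  shows "vertex_of n glue c = {c}"
proof -
  have ends: "end_corner n (c, False) = c" "end_corner n (prv n c, True) = c"
    using c by (simp_all add: end_corner_def nxt_prv)
  have fold_sym: "end_partner glue (prv n c, True) = (c, False)"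
    using end_partner_involution[OF pg, of "(c, False)"] fold by simp
  have stays: "z = c" if rel: "corner_rel n glue c z" for z
  proof -
    obtain x where x: "glue (fst x) \<noteq> None" "end_corner n x = c"
      "end_corner n (end_partner glue x) = z"
      using rel unfolding corner_rel_iff by blast
    from pg x(1) have "fst x \<in> sides F n"
      by (rule glued_side_in_sides)
    then have "x = (c, False) \<or> x = (prv n c, True)"
      using x(2) by (rule side_end_at_corner)
    with x(3) ends fold fold_sym show "z = c" by auto
  qed
  have "d = c" if "(\<lambda>x y. corner_rel n glue x y \<or> corner_rel n glue y x)\<^sup>*\<^sup>* c d" for d
    using that
  proof (induction rule: rtranclp_induct)
    case (step y z)
    then have "corner_rel n glue c z"
      using corner_rel_sym[OF pg] by blast
    then show ?case by (rule stays)
  qed simp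
  then show ?thesis by (auto simp: vertex_of_def)
qed

lemma degp_eq_2_imp_boundary_side:
  assumes pg: "proper_gluing F n glue" and c: "c \<in> sides F n"
    and deg: "3 \<le> deg F n glue c" and degp: "degp n glue c = 2"
  shows "glue c = None \<or> glue (prv n c) = None"
proof (rule ccontr)
  define V where "V = vertex_of n glue c"
  define SE where "SE = {se. fst se \<in> sides F n \<and> end_corner n se \<in> V}"
  define ep where "ep = end_partner glue"
  define x1 where "x1 = (c, False)"
  define x2 where "x2 = (prv n c, True)"
  assume "\<not> (glue c = None \<or> glue (prv n c) = None)"
  then have g1: "glue (fst x1) \<noteq> None" and g2: "glue (fst x2) \<noteq> None"
    by (auto simp: x1_def x2_def)
  have "c \<in> V" by (simp add: V_def vertex_of_def)
  with degp obtain c' where V: "V = {c, c'}"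
    unfolding degp_def V_def[symmetric] by (metis card_2_iff insert_commute insertE singletonD)
  have SE4: "SE \<subseteq> {x1, x2, (c', False), (prv n c', True)}"
  proof
    fix x assume "x \<in> SE"
    then have "fst x \<in> sides F n" "end_corner n x \<in> {c, c'}"
      by (simp_all add: SE_def V)
    then show "x \<in> {x1, x2, (c', False), (prv n c', True)}"
      using side_end_at_corner[of x F n] unfolding x1_def x2_def by blast
  qed
  have "end_corner n x1 = c" "end_corner n x2 = c"
    using c by (simp_all add: x1_def x2_def end_corner_def nxt_prv)
  then have "end_corner n x1 \<in> V" "end_corner n x2 \<in> V"
    using \<open>c \<in> V\<close> by simp_all
  then have "end_corner n (ep x1) \<in> V" "end_corner n (ep x2) \<in> V"
    unfolding V_def ep_def by (simp_all add: end_partner_at_vertex)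
  moreover have "fst (ep x1) \<in> sides F n" "fst (ep x2) \<in> sides F n"
    using end_partner_glued(2)[OF pg] g1 g2 by (simp_all add: ep_def)
  ultimately have "ep x1 \<in> SE" "ep x2 \<in> SE"
    by (simp_all add: SE_def)
  have "ep x1 \<noteq> x2"
  proof
    assume "ep x1 = x2"
    then have "V = {c}"
      using vertex_of_fold[OF pg c] by (simp add: V_def ep_def x1_def x2_def)
    with degp show False by (simp add: V_def degp_def)
  qed
  have inv: "ep (ep x) = x" for x
    using end_partner_involution[OF pg] by (simp add: ep_def)
  have "ep x1 \<noteq> x1" "ep x2 \<noteq> x2"
    using end_partner_glued(1)[OF pg] g1 g2 by (simp_all add: ep_def)
  moreover have "x1 \<noteq> x2"
    by (simp add: x1_def x2_def)
  moreover have "ep x2 \<noteq> x1"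
    using \<open>ep x1 \<noteq> x2\<close> inv[of x2] by metis
  moreover have "ep x1 \<noteq> ep x2"
    using \<open>x1 \<noteq> x2\<close> inv[of x1] inv[of x2] by metis
  moreover have "ep x1 \<in> {x1, x2, (c', False), (prv n c', True)}"
    "ep x2 \<in> {x1, x2, (c', False), (prv n c', True)}"
    using SE4 \<open>ep x1 \<in> SE\<close> \<open>ep x2 \<in> SE\<close> by blast+
  ultimately have "{(c', False), (prv n c', True)} \<subseteq> {ep x1, ep x2}"
    using \<open>ep x1 \<noteq> x2\<close> by auto
  with SE4 have "SE \<subseteq> {x1, x2, ep x1, ep x2}"
    by auto
  then have "edge_end glue ` SE \<subseteq> edge_end glue ` {x1, x2, ep x1, ep x2}"
    by (rule image_mono)
  also have "\<dots> = {edge_end glue x1, edge_end glue x2}"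
    using edge_end_end_partner[OF pg] by (auto simp: ep_def)
  finally have "edge_end glue ` SE \<subseteq> {edge_end glue x1, edge_end glue x2}" .
  then have "deg F n glue c \<le> card {edge_end glue x1, edge_end glue x2}"
    unfolding deg_def V_def[symmetric] SE_def[symmetric] by (rule card_mono[rotated]) simp
  also have "\<dots> \<le> 2"
    by (simp add: card_insert_le_m1)
  finally show False using deg by simp
qed

text \<open>degp c = 0 only for an infinite vertex class (card = 0); then 1/0 = 0 and the bound is trivial.\<close>
lemma inverse_degp_le_side_weights:
  assumes pg: "proper_gluing F n glue" and c: "c \<in> sides F n" and deg: "3 \<le> deg F n glue c"
  shows "1 / real (degp n glue c)
           \<le> (1 / real (eps glue (prv n c)) + 1 / real (eps glue c)) / 2 - 1 / 6"
proof -
  have w: "1 / real (eps glue s) = (if glue s = None then 1 else 1 / 2)" for s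
    by (simp add: eps_def)
  have "degp n glue c \<noteq> 1"
    using deg by (rule degp_neq_1)
  then consider "degp n glue c = 0" | "degp n glue c = 2" | "3 \<le> degp n glue c"
    by linarith
  then show ?thesis
  proof cases
    case 1
    then show ?thesis by (simp add: w)
  next
    case 2
    with degp_eq_2_imp_boundary_side[OF pg c deg 2] show ?thesis
      by (elim disjE) (simp_all add: w)
  next
    case 3
    then have "1 / real (degp n glue c) \<le> 1 / 3"
      by (intro divide_left_mono) simp_all
    then show ?thesis by (simp add: w)
  qed
qed

lemma sum_lessThan_rotate_prev:
  fixes f :: "nat \<Rightarrow> 'a::comm_monoid_add"
  shows "(\<Sum>i<m. f ((i + m - 1) mod m)) = (\<Sum>i<m. f i)"
proof (cases m)
  case (Suc k)
  have "(\<Sum>i<Suc k. f ((i + Suc k - 1) mod Suc k))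
          = f k + (\<Sum>i<k. f ((Suc i + Suc k - 1) mod Suc k))"
    by (subst sum.lessThan_Suc_shift) simp
  also have "(\<Sum>i<k. f ((Suc i + Suc k - 1) mod Suc k)) = (\<Sum>i<k. f i)"
    by (rule sum.cong) (simp_all add: mod_if)
  finally show ?thesis
    using Suc by (simp add: add.commute)
qed simp

lemma sum_inverse_degp_le:
  assumes pg: "proper_gluing F n glue" and P: "P \<in> F"
    and deg: "\<forall>i<n P. 3 \<le> deg F n glue (P, i)"
  shows "(\<Sum>i<n P. 1 / real (degp n glue (P, i)))
           \<le> (\<Sum>i<n P. 1 / real (eps glue (P, i))) - real (n P) / 6"
proof -
  define a where "a i = 1 / real (eps glue (P, i))" for i
  have "(\<Sum>i<n P. 1 / real (degp n glue (P, i)))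
          \<le> (\<Sum>i<n P. (a ((i + n P - 1) mod n P) + a i) / 2 - 1 / 6)"
  proof (rule sum_mono)
    fix i assume "i \<in> {..<n P}"
    then have "(P, i) \<in> sides F n" and "3 \<le> deg F n glue (P, i)"
      using P deg by (auto simp: sides_def)
    from inverse_degp_le_side_weights[OF pg this]
    show "1 / real (degp n glue (P, i)) \<le> (a ((i + n P - 1) mod n P) + a i) / 2 - 1 / 6"
      by (simp add: a_def prv_def)
  qed
  also have "\<dots> = ((\<Sum>i<n P. a ((i + n P - 1) mod n P)) + (\<Sum>i<n P. a i)) / 2 - real (n P) / 6"
    by (simp add: sum_subtractf sum.distrib sum_divide_distrib[symmetric])
  also have "\<dots> = (\<Sum>i<n P. a i) - real (n P) / 6"
    using sum_lessThan_rotate_prev[of a "n P"] by simp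
  finally show ?thesis by (simp add: a_def)
qed

lemma beta_eq_num_sides: "\<forall>i<n P. 3 \<le> deg F n glue (P, i) \<Longrightarrow> beta F n glue P = n P"
  by (simp add: beta_def beta_v_def)

theorem proposition4p5:
  fixes S :: "'a set" and R :: "'a word set" and F :: "'f set" and n :: "'f \<Rightarrow> nat"
    and glue :: "'f \<times> nat \<Rightarrow> (('f \<times> nat) \<times> bool) option"
    and lab :: "'f \<times> nat \<Rightarrow> 'a word" and P :: 'f
  assumes "vk_diagram S R F n glue lab"
    and "P \<in> F"
  shows "- kappa n glue P \<ge> (real (beta F n glue P) - 6) / 6"
proof -
  have pg: "proper_gluing F n glue"
    using assms(1) by (rule vk_diagram_proper_gluing)
  have deg: "\<forall>i<n P. 3 \<le> deg F n glue (P, i)"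
    using assms unfolding vk_diagram_def sides_def by blast
  have "beta F n glue P = n P"
    using deg by (rule beta_eq_num_sides)
  with sum_inverse_degp_le[OF pg assms(2) deg] show ?thesis
    unfolding kappa_def by simp
qed

end
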